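(* Let $G$ be a twin-free unit square graph and let $\mathcal{P}$ be a clique-stable partition of $V(G)$ that is invariant under $\mathrm{Aut}(G)$. Then for every $\delta\in\mathrm{Aut}(G[\mathcal{P}])$ there exists $\gamma\in\mathrm{Aut}(G)$ such that $X^\gamma=X^\delta$ for all $X\in\mathcal{P}$.
   Context: A unit square graph is a graph $G$ admitting $f\colon V(G)\to\mathbb{R}^2$ with $vw\in E(G)$ iff $\|f(v)-f(w)\|_\infty\le1$ for distinct $v,w$. $G$ is twin-free if there are no distinct $v,w$ with $N[v]=N[w]$. $\mathcal{M}(G)$ is the set of maximal cliques; $G^*_{\mathcal{M}}$ is the graph on $V(G)\sqcup\mathcal{M}(G)$ with edge set $E(G)\cup\{vC\mid C\in\mathcal{M}(G),v\in C\}$. A partition $\mathcal{Q}$ of the vertex set of a graph $H$ is stable if for all $X,Y\in\mathcal{Q}$ and $v,w\in X$, $|N_H(v)\cap Y|=|N_H(w)\cap Y|$. A partition $\mathcal{P}$ of $V(G)$ into cliques is clique-stable if, letting $\mathcal{P}^*$ be the coarsest partition of $V(G)\cup\mathcal{M}(G)$ stable with respect to $G^*_{\mathcal{M}}$ refining $\mathcal{P}\cup\{\mathcal{M}(G)\}$, one has $\{Z\in\mathcal{P}^*\mid Z\subseteq V(G)\}=\mathcal{P}$. $\mathcal{P}$ is $\mathrm{Aut}(G)$-invariant if every automorphism maps each part to a part. $G[\mathcal{P}]$ is the complete graph on vertex set $\mathcal{P}$ with vertex coloring $X\mapsto|X|$ and edge coloring $XY\mapsto|\{(x,y)\in X\times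 Y\mid xy\in E(G)\}|$; $\mathrm{Aut}(G[\mathcal{P}])$ consists of the permutations of $\mathcal{P}$ preserving vertex and edge colors. *)

theory Defs
  imports Complex_Main "HOL-Library.Disjoint_Sets"
begin

definition graph :: "'a set \<Rightarrow> ('a \<Rightarrow> 'a \<Rightarrow> bool) \<Rightarrow> bool" where
  "graph V E \<longleftrightarrow> finite V \<and> (\<forall>v w. E v w \<longrightarrow> v \<in> V \<and> w \<in> V)
     \<and> (\<forall>v w. E v w \<longrightarrow> E w v) \<and> (\<forall>v. \<not> E v v)"

definition unit_square_graph :: "'a set \<Rightarrow> ('a \<Rightarrow> 'a \<Rightarrow> bool) \<Rightarrow> bool" where
  "unit_square_graph V E \<longleftrightarrow> (\<exists>f :: 'a \<Rightarrow> real \<times> real.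
     \<forall>v\<in>V. \<forall>w\<in>V. v \<noteq> w \<longrightarrow>
       (E v w \<longleftrightarrow> max \<bar>fst (f v) - fst (f w)\<bar> \<bar>snd (f v) - snd (f w)\<bar> \<le> 1))"

definition closed_nbhd :: "'a set \<Rightarrow> ('a \<Rightarrow> 'a \<Rightarrow> bool) \<Rightarrow> 'a \<Rightarrow> 'a set" where
  "closed_nbhd V E v = insert v {w \<in> V. E v w}"

definition twin_free :: "'a set \<Rightarrow> ('a \<Rightarrow> 'a \<Rightarrow> bool) \<Rightarrow> bool" where
  "twin_free V E \<longleftrightarrow> (\<forall>v\<in>V. \<forall>w\<in>V. v \<noteq> w \<longrightarrow> closed_nbhd V E v \<noteq> closed_nbhd V E w)"

definition is_clique :: "'a set \<Rightarrow> ('a \<Rightarrow> 'a \<Rightarrow> bool) \<Rightarrow> 'a set \<Rightarrow> bool" where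
  "is_clique V E C \<longleftrightarrow> C \<subseteq> V \<and> (\<forall>v\<in>C. \<forall>w\<in>C. v \<noteq> w \<longrightarrow> E v w)"

definition max_cliques :: "'a set \<Rightarrow> ('a \<Rightarrow> 'a \<Rightarrow> bool) \<Rightarrow> 'a set set" where
  "max_cliques V E = {C. is_clique V E C \<and> (\<forall>D. is_clique V E D \<and> C \<subseteq> D \<longrightarrow> D = C)}"

definition star_vertices :: "'a set \<Rightarrow> ('a \<Rightarrow> 'a \<Rightarrow> bool) \<Rightarrow> ('a + 'a set) set" where
  "star_vertices V E = Inl ` V \<union> Inr ` max_cliques V E"

fun star_edge :: "'a set \<Rightarrow> ('a \<Rightarrow> 'a \<Rightarrow> bool) \<Rightarrow> ('a + 'a set) \<Rightarrow> ('a + 'a set) \<Rightarrow> bool" where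
  "star_edge V E (Inl v) (Inl w) = E v w"
| "star_edge V E (Inl v) (Inr C) = (C \<in> max_cliques V E \<and> v \<in> C)"
| "star_edge V E (Inr C) (Inl v) = (C \<in> max_cliques V E \<and> v \<in> C)"
| "star_edge V E (Inr C) (Inr D) = False"

definition stable_partition :: "'b set \<Rightarrow> ('b \<Rightarrow> 'b \<Rightarrow> bool) \<Rightarrow> 'b set set \<Rightarrow> bool" where
  "stable_partition VH EH Q \<longleftrightarrow> partition_on VH Q \<and>
     (\<forall>X\<in>Q. \<forall>Y\<in>Q. \<forall>v\<in>X. \<forall>w\<in>X. card {u\<in>Y. EH v u} = card {u\<in>Y. EH w u})"

definition refines :: "'b set set \<Rightarrow> 'b set set \<Rightarrow> bool" where
  "refines Q R \<longleftrightarrow> (\<forall>X\<in>Q. \<exists>Y\<in>R. X \<subseteq> Y)"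

definition coarsest_stable_refinement :: "'b set \<Rightarrow> ('b \<Rightarrow> 'b \<Rightarrow> bool) \<Rightarrow> 'b set set \<Rightarrow> 'b set set \<Rightarrow> bool" where
  "coarsest_stable_refinement VH EH R Q \<longleftrightarrow> stable_partition VH EH Q \<and> refines Q R \<and>
     (\<forall>Q'. stable_partition VH EH Q' \<and> refines Q' R \<longrightarrow> refines Q' Q)"

definition clique_partition :: "'a set \<Rightarrow> ('a \<Rightarrow> 'a \<Rightarrow> bool) \<Rightarrow> 'a set set \<Rightarrow> bool" where
  "clique_partition V E P \<longleftrightarrow> partition_on V P \<and> (\<forall>X\<in>P. is_clique V E X)"

definition P_star :: "'a set \<Rightarrow> ('a \<Rightarrow> 'a \<Rightarrow> bool) \<Rightarrow> 'a set set \<Rightarrow> ('a + 'a set) set set" where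
  "P_star V E P = (THE Q. coarsest_stable_refinement (star_vertices V E) (star_edge V E)
                     ((\<lambda>X. Inl ` X) ` P \<union> {Inr ` max_cliques V E}) Q)"

definition clique_stable :: "'a set \<Rightarrow> ('a \<Rightarrow> 'a \<Rightarrow> bool) \<Rightarrow> 'a set set \<Rightarrow> bool" where
  "clique_stable V E P \<longleftrightarrow> clique_partition V E P \<and>
     {Z \<in> P_star V E P. Z \<subseteq> Inl ` V} = (\<lambda>X. Inl ` X) ` P"

definition graph_aut :: "'a set \<Rightarrow> ('a \<Rightarrow> 'a \<Rightarrow> bool) \<Rightarrow> ('a \<Rightarrow> 'a) \<Rightarrow> bool" where
  "graph_aut V E \<gamma> \<longleftrightarrow> bij_betw \<gamma> V V \<and> (\<forall>v\<in>V. \<forall>w\<in>V. E (\<gamma> v) (\<gamma> w) \<longleftrightarrow> E v w)"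

definition aut_invariant :: "'a set \<Rightarrow> ('a \<Rightarrow> 'a \<Rightarrow> bool) \<Rightarrow> 'a set set \<Rightarrow> bool" where
  "aut_invariant V E P \<longleftrightarrow> (\<forall>\<gamma>. graph_aut V E \<gamma> \<longrightarrow> (\<forall>X\<in>P. \<gamma> ` X \<in> P))"

definition edge_count :: "('a \<Rightarrow> 'a \<Rightarrow> bool) \<Rightarrow> 'a set \<Rightarrow> 'a set \<Rightarrow> nat" where
  "edge_count E X Y = card {(x, y). x \<in> X \<and> y \<in> Y \<and> E x y}"

text \<open>Automorphisms of the coloured complete graph G[P].\<close>
definition quotient_aut :: "('a \<Rightarrow> 'a \<Rightarrow> bool) \<Rightarrow> 'a set set \<Rightarrow> ('a set \<Rightarrow> 'a set) \<Rightarrow> bool" where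
  "quotient_aut E P \<delta> \<longleftrightarrow> bij_betw \<delta> P P \<and> (\<forall>X\<in>P. card (\<delta> X) = card X) \<and>
     (\<forall>X\<in>P. \<forall>Y\<in>P. X \<noteq> Y \<longrightarrow> edge_count E (\<delta> X) (\<delta> Y) = edge_count E X Y)"

end

theory Submission
  imports Defs
begin

text \<open>
  Fix a realization and let \<open>a\<close> be its first coordinate.  Two disjoint cliques \<open>X\<close>, \<open>Y\<close> lie in unit
  boxes, so for each coordinate only one of the two inequalities in \<open>|x - y| \<le> 1\<close> can fail; hence
  adjacency between them is a dominance relation in the plane.  Stability makes it biregular, and a
  biregular dominance relation is a disjoint union of complete bipartite graphs whose blocks are
  ordered the same way by \<open>a\<close> on both sides.  Twin-freeness makes \<open>a\<close> injective on each part, so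
  adjacency between \<open>X\<close> and \<open>Y\<close> can be read off from the ranks with respect to \<open>a\<close>, the sizes of
  the parts and the number of edges between them.  The rank-preserving bijections
  \<open>X \<rightarrow> \<delta> X\<close> therefore combine to an automorphism.
\<close>

section \<open>Coarsest stable refinements\<close>

lemma partition_refines_antisym:
  assumes "partition_on A P" "partition_on A Q" "refines P Q" "refines Q P"
  shows "P = Q"
proof -
  have "P \<subseteq> Q" if PQ: "partition_on A P" "refines P Q" "refines Q P" for P Q
  proof
    fix Z assume Z: "Z \<in> P"
    obtain Y where Y: "Y \<in> Q" "Z \<subseteq> Y" using Z PQ(2) by (auto simp: refines_def)
    obtain Z' where Z': "Z' \<in> P" "Y \<subseteq> Z'" using Y PQ(3) by (auto simp: refines_def)
    have "Z \<noteq> {}" using Z PQ(1) by (auto simp: partition_on_def)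
    then have "Z \<inter> Z' \<noteq> {}" using Y Z' by blast
    then have "Z = Z'" using Z Z' PQ(1) by (auto simp: partition_on_def disjoint_def)
    then show "Z \<in> Q" using Y Z' by auto
  qed
  then show ?thesis using assms by blast
qed

text \<open>A saturated \<open>Y\<close> is a disjoint union of cells of \<open>Q\<close>, so the
  count into \<open>Y\<close> is a sum of counts that are each constant on \<open>Z\<close>. This is
  how stability passes to joins of stable partitions.\<close>

lemma stable_partition_card_union:
  assumes "finite VH" "stable_partition VH EH Q" "Z \<in> Q" "v \<in> Z" "w \<in> Z" "Y \<subseteq> VH"
    and saturated: "\<And>Z. Z \<in> Q \<Longrightarrow> Z \<inter> Y \<noteq> {} \<Longrightarrow> Z \<subseteq> Y"
  shows "card {u\<in>Y. EH v u} = card {u\<in>Y. EH w u}"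
proof -
  have part: "partition_on VH Q" using assms(2) by (simp add: stable_partition_def)
  let ?C = "{Z\<in>Q. Z \<subseteq> Y}"
  have C: "Y = \<Union>?C"
  proof
    show "Y \<subseteq> \<Union>?C"
    proof
      fix u assume u: "u \<in> Y"
      then obtain Z where "Z \<in> Q" "u \<in> Z" using part assms(6) unfolding partition_on_def by blast
      then show "u \<in> \<Union>?C" using saturated[of Z] u by blast
    qed
  qed blast
  have fin: "finite ?C" using assms(1,6) finite_subset[of Y VH] by (auto intro: finite_subset[of _ "Pow Y"])
  have "card {u\<in>Y. EH x u} = (\<Sum>Z\<in>?C. card {u\<in>Z. EH x u})" for x
  proof -
    have "{u\<in>Y. EH x u} = (\<Union>Z\<in>?C. {u\<in>Z. EH x u})" using C by blast
    also have "card \<dots> = (\<Sum>Z\<in>?C. card {u\<in>Z. EH x u})"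
    proof (rule card_UN_disjoint[OF fin])
      show "\<forall>Z\<in>?C. finite {u \<in> Z. EH x u}"
        using assms(1,6) by (auto intro: finite_subset[of _ VH])
      show "\<forall>i\<in>?C. \<forall>j\<in>?C. i \<noteq> j \<longrightarrow> {u \<in> i. EH x u} \<inter> {u \<in> j. EH x u} = {}"
        using part unfolding partition_on_def disjoint_def by blast
    qed
    finally show ?thesis .
  qed
  moreover have "(\<Sum>Z\<in>?C. card {u\<in>Z. EH v u}) = (\<Sum>Z\<in>?C. card {u\<in>Z. EH w u})"
    using assms(2-5) unfolding stable_partition_def by (intro sum.cong) blast+
  ultimately show ?thesis by metis
qed

text \<open>The witness is the join of all stable refinements of \<open>R\<close>: the classes of
  the transitive closure of the union of their equivalence relations.\<close>

lemma ex_coarsest_stable_refinement: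
  assumes fin: "finite VH" and disj: "disjoint R" and cover: "\<Union>R = VH"
  shows "\<exists>Q. coarsest_stable_refinement VH EH R Q"
proof -
  define rel where "rel = {(v, w). \<exists>Q. stable_partition VH EH Q \<and> refines Q R \<and> (\<exists>Z\<in>Q. v \<in> Z \<and> w \<in> Z)}"
  let ?r = "rel\<^sup>+"
  \<comment> \<open>The partition into singletons makes \<open>rel\<close> reflexive, so the closure
    really is an equivalence on all of \<open>VH\<close>.\<close>
  have discrete: "stable_partition VH EH ((\<lambda>v. {v}) ` VH)" "refines ((\<lambda>v. {v}) ` VH) R"
    using cover by (auto simp: stable_partition_def partition_on_def disjoint_def refines_def)
  have in_rel: "rel \<subseteq> VH \<times> VH"
    by (auto simp: rel_def stable_partition_def partition_on_def)
  have equiv: "equiv VH ?r"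
  proof (rule equivI)
    show "?r \<subseteq> VH \<times> VH" by (rule trancl_subset_Sigma[OF in_rel])
    have "(v, v) \<in> rel" if "v \<in> VH" for v
      using discrete that unfolding rel_def by blast
    then show "refl_on VH ?r" by (auto simp: refl_on_def)
    have "sym rel" unfolding rel_def sym_def by blast
    then show "sym ?r" by (rule sym_trancl)
    show "trans ?r" by (rule trans_trancl)
  qed
  have saturated: "Z \<subseteq> Y" if Q: "stable_partition VH EH Q" "refines Q R" "Z \<in> Q" and Y: "Y \<in> VH // ?r" "Z \<inter> Y \<noteq> {}"
    for Q Z Y
  proof
    fix w assume w: "w \<in> Z"
    obtain v where v: "v \<in> Z" "v \<in> Y" using Y(2) by blast
    then have "(v, w) \<in> ?r" using Q w unfolding rel_def by blast
    then show "w \<in> Y" using v(2) Y(1) equiv by (meson in_quotient_imp_closed)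
  qed
  have stable: "stable_partition VH EH (VH // ?r)"
    unfolding stable_partition_def
  proof (intro conjI ballI)
    show "partition_on VH (VH // ?r)" by (rule partition_on_quotient[OF equiv])
    fix X Y v w assume X: "X \<in> VH // ?r" and Y: "Y \<in> VH // ?r" and v: "v \<in> X" and w: "w \<in> X"
    have "(v, w) \<in> ?r" using X v w equiv by (meson in_quotient_imp_in_rel empty_subsetI insert_subset)
    \<comment> \<open>Different links of a chain may come from different stable partitions; each
      link preserves the count into \<open>Y\<close>, since \<open>Y\<close> is saturated for every
      one of them.\<close>
    moreover have step: "card {u\<in>Y. EH x u} = card {u\<in>Y. EH z u}" if xz: "(x, z) \<in> rel" for x z
    proof -
      obtain Q Z where Q: "stable_partition VH EH Q" "refines Q R" "Z \<in> Q" "x \<in> Z" "z \<in> Z"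
        using xz unfolding rel_def by blast
      show ?thesis
        using stable_partition_card_union[OF fin Q(1,3-5)] in_quotient_imp_subset[OF equiv Y]
          saturated[OF Q(1,2) _ Y] by blast
    qed
    ultimately show "card {u\<in>Y. EH v u} = card {u\<in>Y. EH w u}"
      by (induction rule: trancl_induct) auto
  qed
  have "refines (VH // ?r) R"
    unfolding refines_def
  proof
    fix X assume X: "X \<in> VH // ?r"
    then obtain v where v: "v \<in> VH" "X = ?r `` {v}" by (rule quotientE)
    obtain T where T: "T \<in> R" "v \<in> T" using v cover by blast
    \<comment> \<open>Disjointness of \<open>R\<close> keeps a chain inside the part where it
      starts.\<close>
    have step: "y \<in> T" if yz: "(x, y) \<in> rel" "x \<in> T" for x y
    proof -
      obtain Q Z where Q: "refines Q R" "Z \<in> Q" "x \<in> Z" "y \<in> Z" using yz unfolding rel_def by blast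
      then obtain T' where "T' \<in> R" "Z \<subseteq> T'" by (auto simp: refines_def)
      moreover then have "T' = T" using disj T(1) yz(2) Q(3) by (auto simp: disjoint_def)
      ultimately show ?thesis using Q by auto
    qed
    have "w \<in> T" if "(v, w) \<in> ?r" for w
      using that by (induction rule: trancl_induct) (use step T in blast)+
    then show "\<exists>T\<in>R. X \<subseteq> T" using v T by auto
  qed
  moreover have "refines Q (VH // ?r)" if Q: "stable_partition VH EH Q" "refines Q R" for Q
    unfolding refines_def
  proof
    fix Z assume Z: "Z \<in> Q"
    have part: "partition_on VH Q" using Q by (simp add: stable_partition_def)
    then have "Z \<noteq> {}" "Z \<subseteq> VH" using Z by (auto simp: partition_on_def)
    then obtain v where v: "v \<in> Z" "v \<in> VH" by blast
    have "v \<in> ?r `` {v}" by (rule equiv_class_self[OF equiv v(2)])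
    then have "Z \<inter> ?r `` {v} \<noteq> {}" using v(1) by blast
    then have "Z \<subseteq> ?r `` {v}" by (rule saturated[OF Q Z quotientI[OF v(2)]])
    then show "\<exists>Y\<in>VH // ?r. Z \<subseteq> Y" using quotientI[OF v(2)] by blast
  qed
  ultimately show ?thesis using stable unfolding coarsest_stable_refinement_def by blast
qed

lemma coarsest_stable_refinement_unique:
  assumes "coarsest_stable_refinement VH EH R Q" "coarsest_stable_refinement VH EH R Q'"
  shows "Q = Q'"
proof (rule partition_refines_antisym)
  show "partition_on VH Q" "partition_on VH Q'"
    using assms by (simp_all add: coarsest_stable_refinement_def stable_partition_def)
  show "refines Q Q'" "refines Q' Q"
    using assms by (simp_all add: coarsest_stable_refinement_def)
qed

lemma finite_max_cliques: "finite V \<Longrightarrow> finite (max_cliques V E)"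
  by (rule finite_subset[of _ "Pow V"]) (auto simp: max_cliques_def is_clique_def)

text \<open>Existence and uniqueness together license the definite description in
  \<open>P_star\<close>.\<close>

lemma stable_P_star:
  assumes "finite V" "partition_on V P"
  shows "stable_partition (star_vertices V E) (star_edge V E) (P_star V E P)"
proof -
  let ?R = "(\<lambda>X. Inl ` X) ` P \<union> {Inr ` max_cliques V E}"
  have "\<exists>Q. coarsest_stable_refinement (star_vertices V E) (star_edge V E) ?R Q"
  proof (rule ex_coarsest_stable_refinement)
    show "finite (star_vertices V E)"
      using assms(1) finite_max_cliques by (auto simp: star_vertices_def)
    show "disjoint ?R" using assms(2) by (auto simp: disjoint_def partition_on_def)
    show "\<Union>?R = star_vertices V E" using assms(2) by (auto simp: star_vertices_def partition_on_def)
  qed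
  then have "coarsest_stable_refinement (star_vertices V E) (star_edge V E) ?R (P_star V E P)"
    unfolding P_star_def using coarsest_stable_refinement_unique by (metis (no_types, lifting) theI)
  then show ?thesis by (simp add: coarsest_stable_refinement_def)
qed

text \<open>The copies of the parts are themselves cells of \<open>P_star\<close>, and between two
  such cells \<open>star_edge\<close> is just \<open>E\<close>.\<close>

lemma clique_stable_imp_stable_partition:
  assumes "finite V" "clique_stable V E P"
  shows "stable_partition V E P"
proof -
  have part: "partition_on V P" and eq: "{Z \<in> P_star V E P. Z \<subseteq> Inl ` V} = (\<lambda>X. Inl ` X) ` P"
    using assms(2) by (auto simp: clique_stable_def clique_partition_def)
  have star: "stable_partition (star_vertices V E) (star_edge V E) (P_star V E P)"
    using stable_P_star assms(1) part by blast
  show ?thesis unfolding stable_partition_def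
  proof (intro conjI ballI part)
    fix X Y v w assume X: "X \<in> P" and Y: "Y \<in> P" and v: "v \<in> X" and w: "w \<in> X"
    have in_star: "Inl ` X \<in> P_star V E P" "Inl ` Y \<in> P_star V E P" using eq X Y by blast+
    have "card {u\<in>Y. E x u} = card {u\<in>Inl ` Y. star_edge V E (Inl x) u}" for x
    proof -
      have "{u\<in>Inl ` Y. star_edge V E (Inl x) u} = Inl ` {u\<in>Y. E x u}" by auto
      then show ?thesis by (simp add: card_image)
    qed
    moreover have "card {u\<in>Inl ` Y. star_edge V E (Inl v) u} = card {u\<in>Inl ` Y. star_edge V E (Inl w) u}"
      using star in_star v w unfolding stable_partition_def by blast
    ultimately show "card {u\<in>Y. E v u} = card {u\<in>Y. E w u}" by simp
  qed
qed

section \<open>Biregular dominance relations\<close>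

text \<open>The conclusion says that neighbourhoods which meet coincide, that is, \<open>R\<close>
  is a disjoint union of complete bipartite graphs. Regularity enters by forbidding proper inclusion
  between neighbourhoods, on either side.\<close>

lemma biregular_dominance_difunctional:
  fixes p r :: "'b \<Rightarrow> real" and q s :: "'a \<Rightarrow> real"
  assumes "finite X" "finite Y"
    and R: "\<And>x y. x \<in> X \<Longrightarrow> y \<in> Y \<Longrightarrow> R x y \<longleftrightarrow> p y \<le> q x \<and> r y \<le> s x"
    and degX: "\<And>x. x \<in> X \<Longrightarrow> card {y\<in>Y. R x y} = d"
    and degY: "\<And>y. y \<in> Y \<Longrightarrow> card {x\<in>X. R x y} = e"
    and "x \<in> X" "x' \<in> X" "y \<in> Y" "y' \<in> Y" "R x y" "R x' y" "R x y'"
  shows "R x' y'"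
proof (rule ccontr)
  assume "\<not> R x' y'"
  \<comment> \<open>Descent: a vertex whose neighbourhood overlaps another one without being equal to it produces
    such a vertex with a smaller value of \<open>q\<close>.\<close>
  define N where "N x = {y\<in>Y. R x y}" for x
  define M where "M y = {x\<in>X. R x y}" for y
  define bad where "bad = {x\<in>X. \<exists>x'\<in>X. N x \<inter> N x' \<noteq> {} \<and> N x \<noteq> N x'}"
  have Neq: "N x = N x'" if "x \<in> X" "x' \<in> X" "N x \<subseteq> N x'" for x x'
    using that degX assms(2) by (intro card_subset_eq) (auto simp: N_def)
  have Meq: "M y = M y'" if "y \<in> Y" "y' \<in> Y" "M y \<subseteq> M y'" for y y'
    using that degY assms(1) by (intro card_subset_eq) (auto simp: M_def)
  have "x \<in> bad" using assms(6-) \<open>\<not> R x' y'\<close> unfolding bad_def N_def by blast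
  then obtain x0 where x0: "x0 \<in> bad" and min: "\<And>z. z \<in> bad \<Longrightarrow> q x0 \<le> q z"
    using arg_min_least[of bad _ q] arg_min_if_finite(1)[of bad q] assms(1) finite_subset[of bad X]
    by (metis (no_types, lifting) bad_def empty_iff mem_Collect_eq subsetI)
  then obtain x1 where x1: "x1 \<in> X" "N x0 \<inter> N x1 \<noteq> {}" "N x0 \<noteq> N x1" and x0X: "x0 \<in> X"
    by (auto simp: bad_def)
  then have "x1 \<in> bad" unfolding bad_def by blast
  then have q01: "q x0 \<le> q x1" by (rule min)
  obtain u where u: "u \<in> N x0" "u \<in> N x1" using x1 by blast
  obtain w where w: "w \<in> N x0" "w \<notin> N x1" using Neq x0X x1 by blast
  \<comment> \<open>Since \<open>p w \<le> q x0 \<le> q x1\<close>, the non-edge between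
    \<open>x1\<close> and \<open>w\<close> must fail in the second coordinate:
    \<open>r u \<le> s x1 < r w\<close>.\<close>
  have ru: "r u < r w" using u w x0X x1(1) q01 R by (fastforce simp: N_def)
  have uY: "u \<in> Y" "w \<in> Y" using u w by (auto simp: N_def)
  have "M w \<noteq> M u" using u w x1(1) by (auto simp: N_def M_def)
  then obtain x2 where x2: "x2 \<in> X" "R x2 w" "\<not> R x2 u"
    using Meq[OF uY(2,1)] by (auto simp: M_def)
  \<comment> \<open>From \<open>r u < r w \<le> s x2\<close>, the non-edge between \<open>x2\<close>
    and \<open>u\<close> must fail in the first coordinate.\<close>
  have "q x2 < p u" using ru x2 R uY by fastforce
  also have "p u \<le> q x0" using u x0X R by (auto simp: N_def)
  finally have less: "q x2 < q x0" .
  have "w \<in> N x2 \<inter> N x0" "u \<in> N x0" "u \<notin> N x2" using x2 w u uY by (auto simp: N_def)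
  then have "x2 \<in> bad" using x2(1) x0X unfolding bad_def by blast
  then show False using min less by force
qed

text \<open>If the first cross pair fails in the first coordinate, then
  \<open>p y \<le> q x < p y' \<le> q x'\<close>. If it fails in the second, the other cross pair
  cannot, and the reversed chain holds.\<close>

lemma dominance_order:
  fixes p r :: "'b \<Rightarrow> real" and q s :: "'a \<Rightarrow> real"
  assumes "p y \<le> q x \<and> r y \<le> s x" "p y' \<le> q x' \<and> r y' \<le> s x'"
    "\<not> (p y' \<le> q x \<and> r y' \<le> s x)" "\<not> (p y \<le> q x' \<and> r y \<le> s x')"
  shows "(q x < q x' \<and> p y < p y') \<or> (q x' < q x \<and> p y' < p y)"
proof (cases "p y' \<le> q x")
  case True
  then have "s x < r y'" "r y' \<le> s x'" "r y \<le> s x" using assms by auto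
  then have "q x' < p y" using assms(4) by linarith
  then show ?thesis using assms(1,2) by linarith
next
  case False
  then show ?thesis using assms(1,2) by linarith
qed

section \<open>Adjacency in terms of ranks\<close>

text \<open>Ranks start at 0, so that dividing by the block size gives the index of the
  block.\<close>

definition rank_in :: "('a \<Rightarrow> real) \<Rightarrow> 'a set \<Rightarrow> 'a \<Rightarrow> nat" where
  "rank_in a X x = card {x'\<in>X. a x' < a x}"

lemma bij_betw_rank_in:
  assumes "finite X" "inj_on a X"
  shows "bij_betw (rank_in a X) X {..<card X}"
proof -
  have less: "rank_in a X x < rank_in a X y" if "x \<in> X" "y \<in> X" "a x < a y" for x y
    unfolding rank_in_def using assms(1) that by (intro psubset_card_mono) auto
  have "inj_on (rank_in a X) X"
  proof (rule inj_onI)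
    fix x y assume xy: "x \<in> X" "y \<in> X" "rank_in a X x = rank_in a X y"
    then have "a x = a y" using less[of x y] less[of y x] by force
    then show "x = y" using assms(2) xy by (auto dest: inj_onD)
  qed
  moreover have "rank_in a X ` X \<subseteq> {..<card X}"
    unfolding rank_in_def using assms(1) by (auto intro!: psubset_card_mono)
  ultimately show ?thesis
    by (simp add: bij_betw_def card_image card_subset_eq)
qed

text \<open>A disjoint union of complete bipartite blocks, each with \<open>e\<close> vertices in
  \<open>X\<close> and \<open>d\<close> in \<open>Y\<close>; \<open>ordered\<close> says that the
  blocks come in the same order on both sides.\<close>

locale ordered_blocks =
  fixes X :: "'a set" and Y :: "'b set" and R :: "'a \<Rightarrow> 'b \<Rightarrow> bool"
    and a :: "'a \<Rightarrow> real" and c :: "'b \<Rightarrow> real" and d e :: nat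
  assumes finX: "finite X" and finY: "finite Y"
    and d: "0 < d" and e: "0 < e"
    and degX: "x \<in> X \<Longrightarrow> card {y\<in>Y. R x y} = d"
    and degY: "y \<in> Y \<Longrightarrow> card {x\<in>X. R x y} = e"
    and difunctional: "\<lbrakk>x \<in> X; x' \<in> X; y \<in> Y; y' \<in> Y; R x y; R x' y; R x y'\<rbrakk> \<Longrightarrow> R x' y'"
    and ordered: "\<lbrakk>x \<in> X; x' \<in> X; y \<in> Y; y' \<in> Y; R x y; R x' y'; \<not> R x y'\<rbrakk>
      \<Longrightarrow> (a x < a x' \<and> c y < c y') \<or> (a x' < a x \<and> c y' < c y)"
begin

text \<open>The \<open>X\<close>-sides of all blocks preceding that of \<open>x\<close>; the witness
  \<open>y\<close> expresses that \<open>x\<close> and \<open>x'\<close> lie in different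
  blocks.\<close>

definition below :: "'a \<Rightarrow> 'a set" where
  "below x = {x'\<in>X. a x' < a x \<and> (\<exists>y\<in>Y. R x y \<and> \<not> R x' y)}"

lemma ex_right: "x \<in> X \<Longrightarrow> \<exists>y\<in>Y. R x y"
  using degX[of x] d by (metis (mono_tags, lifting) card.empty empty_Collect_eq less_irrefl)

lemma ex_left: "y \<in> Y \<Longrightarrow> \<exists>x\<in>X. R x y"
  using degY[of y] e by (metis (mono_tags, lifting) card.empty empty_Collect_eq less_irrefl)

text \<open>In \<open>ordered\<close> only one cross pair is assumed non-adjacent; by
  \<open>difunctional\<close> the other one then is too, which makes the assumptions
  symmetric.\<close>

lemma swap: "ordered_blocks Y X (\<lambda>y x. R x y) c a e d"
proof
  fix y y' x x' assume *: "y \<in> Y" "y' \<in> Y" "x \<in> X" "x' \<in> X" "R x y" "R x' y'" "\<not> R x' y"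
  then have "\<not> R x y'" using difunctional by blast
  then show "(c y < c y' \<and> a x < a x') \<or> (c y' < c y \<and> a x' < a x)"
    using ordered[OF *(3,4,1,2,5,6)] by blast
next
  fix y y' x x' assume "y \<in> Y" "y' \<in> Y" "x \<in> X" "x' \<in> X" "R x y" "R x y'" "R x' y"
  then show "R x' y'" using difunctional by blast
qed (simp_all add: finX finY d e degX degY)

text \<open>The order is carried from \<open>x'\<close> across to \<open>y'\<close> and back to
  \<open>x''\<close>, so a block precedes \<open>x\<close> as a whole.\<close>

lemma below_saturated:
  assumes "x \<in> X" "x' \<in> below x" "x'' \<in> X" "y' \<in> Y" "R x' y'" "R x'' y'"
  shows "x'' \<in> below x"
proof -
  obtain y where y: "y \<in> Y" "R x y" "\<not> R x' y" and x': "x' \<in> X" "a x' < a x"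
    using assms(2) by (auto simp: below_def)
  have "c y' < c y" using ordered[OF x'(1) assms(1,4) y(1) assms(5) y(2,3)] x' by auto
  moreover have n: "\<not> R x'' y" using difunctional assms y x' by metis
  ultimately have "a x'' < a x"
    using ordered[OF assms(3,1,4) y(1) assms(6) y(2) n] by auto
  then show ?thesis using n y assms by (auto simp: below_def)
qed

lemma dvd_card_below:
  assumes "x \<in> X" shows "e dvd card (below x)"
proof -
  let ?C = "(\<lambda>y. {x\<in>X. R x y}) ` {y\<in>Y. \<exists>x'\<in>below x. R x' y}"
  have sub: "below x \<subseteq> X" by (auto simp: below_def)
  have U: "\<Union>?C = below x"
  proof
    show "\<Union>?C \<subseteq> below x" using below_saturated[OF assms] by auto
    show "below x \<subseteq> \<Union>?C" using sub ex_right by fastforce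
  qed
  have "e * card ?C = card (\<Union>?C)"
  proof (rule card_partition)
    show "finite ?C" using finY by auto
    show "finite (\<Union>?C)" using U sub finX finite_subset by metis
    show "card A = e" if "A \<in> ?C" for A using that degY by auto
    show "A \<inter> B = {}" if "A \<in> ?C" "B \<in> ?C" "A \<noteq> B" for A B
      using that difunctional by blast
  qed
  then have "card (below x) = e * card ?C" unfolding U by (rule sym)
  then show ?thesis by (rule dvdI)
qed

text \<open>The rank is \<open>card (below x)\<close>, a multiple of \<open>e\<close>, plus the
  number of smaller vertices in the block of \<open>x\<close>. That number is below \<open>e\<close>
  because \<open>x\<close> itself is not counted.\<close>

lemma rank_div:
  assumes "x \<in> X" shows "rank_in a X x div e = card (below x) div e"
proof -
  obtain y where y: "y \<in> Y" "R x y" using ex_right assms by blast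
  let ?S = "{x'\<in>X. R x' y \<and> a x' < a x}"
  have "?S \<subset> {x'\<in>X. R x' y}" using assms y by auto
  then have lt: "card ?S < e" using psubset_card_mono[of "{x'\<in>X. R x' y}" ?S] finX degY y by auto
  have eq: "{x'\<in>X. a x' < a x} = below x \<union> ?S"
    using assms y difunctional unfolding below_def by blast
  have dis: "below x \<inter> ?S = {}"
    using assms y difunctional unfolding below_def by blast
  have "rank_in a X x = card (below x) + card ?S"
    unfolding rank_in_def eq using dis finX by (intro card_Un_disjoint) (auto simp: below_def)
  moreover obtain k where "card (below x) = e * k" using dvd_card_below[OF assms] by auto
  ultimately show ?thesis using lt e by simp
qed

text \<open>\<open>below x'\<close> contains both \<open>below x\<close> and the whole block of
  \<open>x\<close>, which are disjoint, so the quotient grows by at least one.\<close>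

lemma rank_div_less:
  assumes "x \<in> X" "x' \<in> X" "a x < a x'" "y \<in> Y" "R x' y" "\<not> R x y"
  shows "rank_in a X x div e < rank_in a X x' div e"
proof -
  obtain z where z: "z \<in> Y" "R x z" using ex_right assms by blast
  let ?S = "{x\<in>X. R x z}"
  have x: "x \<in> below x'" using assms by (auto simp: below_def)
  have "?S \<subseteq> below x'" using below_saturated[OF assms(2) x] z by blast
  moreover have "below x \<subseteq> below x'"
  proof
    fix w assume w: "w \<in> below x"
    then have wX: "w \<in> X" "a w < a x" by (auto simp: below_def)
    \<comment> \<open>Otherwise \<open>w\<close> lies in the block of \<open>x'\<close>, and
      \<open>a w < a x < a x'\<close> would place \<open>y\<close> both before and after
      \<open>z\<close>.\<close>
    have "\<not> R w y"
    proof
      assume wy: "R w y"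
      have nz: "\<not> R w z" using difunctional[OF wX(1) assms(1) z(1) assms(4)] wy z(2) assms(6) by blast
      have n: "\<not> R x' z" using difunctional[OF assms(2,1) z(1) assms(4)] z(2) assms(5,6) by blast
      show False
        using ordered[OF wX(1) assms(1,4) z(1) wy z(2) nz] ordered[OF assms(2,1,4) z(1) assms(5) z(2) n]
          wX assms(3) by auto
    qed
    then show "w \<in> below x'" using wX assms by (auto simp: below_def)
  qed
  moreover have "below x \<inter> ?S = {}" using assms z difunctional unfolding below_def by blast
  moreover have fin: "finite (below w)" for w using finX by (auto simp: below_def)
  ultimately have "card (below x) + card ?S \<le> card (below x')"
    using finX by (subst card_Un_disjoint[symmetric]) (auto intro!: card_mono)
  then have "card (below x) + e \<le> card (below x')" using degY z by simp
  then have "(card (below x) + e) div e \<le> card (below x') div e" by (rule div_le_mono)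
  then show ?thesis using e assms by (simp add: rank_div)
qed

text \<open>Double counting of the edges in the preceding blocks: with \<open>k\<close> blocks
  counted on the left and \<open>l\<close> on the right, the number is
  \<open>e * k * d = d * l * e\<close>.\<close>

lemma rank_div_eq:
  assumes "x \<in> X" "y \<in> Y" "R x y"
  shows "rank_in a X x div e = rank_in c Y y div d"
proof -
  interpret s: ordered_blocks Y X "\<lambda>y x. R x y" c a e d by (rule swap)
  \<comment> \<open>Each edge has both ends in the preceding blocks or neither, so both sides count
    the same edges.\<close>
  have mem: "x' \<in> below x \<longleftrightarrow> y' \<in> s.below y" if "x' \<in> X" "y' \<in> Y" "R x' y'" for x' y'
  proof (cases "R x y'")
    case True
    then show ?thesis using assms that difunctional unfolding below_def s.below_def by blast
  next
    case False
    then have "\<not> R x' y" using difunctional assms that by blast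
    then show ?thesis using ordered[OF assms(1) that(1) assms(2) that(2) assms(3) that(3) False] False assms that
      unfolding below_def s.below_def by fastforce
  qed
  let ?A = "Sigma (below x) (\<lambda>x'. {y'\<in>Y. R x' y'})"
  let ?B = "Sigma (s.below y) (\<lambda>y'. {x'\<in>X. R x' y'})"
  have sub: "below x \<subseteq> X" "s.below y \<subseteq> Y" by (auto simp: below_def s.below_def)
  have "?B = prod.swap ` ?A" using mem sub by (auto simp: image_iff)
  then have "card ?A = card ?B" by (simp add: card_image)
  moreover have "card ?A = card (below x) * d"
    using sub finX finY degX by (subst card_SigmaI) (auto intro: finite_subset simp: subset_iff)
  moreover have "card ?B = card (s.below y) * e"
    using sub finX finY degY by (subst card_SigmaI) (auto intro: finite_subset simp: subset_iff)
  moreover obtain k where k: "card (below x) = e * k" using dvd_card_below[OF assms(1)] by auto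
  moreover obtain l where l: "card (s.below y) = d * l" using s.dvd_card_below[OF assms(2)] by auto
  ultimately have "k = l" using d e by simp
  then show ?thesis using k l d e assms rank_div s.rank_div by simp
qed

text \<open>For the converse, a neighbour \<open>z\<close> of \<open>y\<close> has the same quotient
  as \<open>x\<close>; were \<open>x\<close> outside the block of \<open>y\<close>,
  \<open>rank_div_less\<close> would separate the two quotients.\<close>

lemma adjacent_iff_rank:
  assumes "x \<in> X" "y \<in> Y"
  shows "R x y \<longleftrightarrow> rank_in a X x div e = rank_in c Y y div d"
proof
  assume eq: "rank_in a X x div e = rank_in c Y y div d"
  show "R x y"
  proof (rule ccontr)
    assume n: "\<not> R x y"
    obtain z where z: "z \<in> X" "R z y" using ex_left assms by blast
    obtain y' where y': "y' \<in> Y" "R x y'" using ex_right assms by blast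
    have n': "\<not> R z y'" using difunctional n z y' assms by blast
    have "rank_in a X z div e = rank_in a X x div e" using rank_div_eq z assms(2) eq by simp
    moreover have "a x < a z \<or> a z < a x" using ordered[OF assms(1) z(1) y'(1) assms(2) y'(2) z(2) n] by auto
    ultimately show False
      using rank_div_less[OF assms(1) z(1) _ assms(2) z(2) n] rank_div_less[OF z(1) assms(1) _ y' n'] by auto
  qed
qed (rule rank_div_eq[OF assms])

end

section \<open>Parts of a stable clique partition\<close>

text \<open>If some \<open>y0\<close> exceeds some \<open>x0\<close> by more than 1, the widths
  force \<open>a x - a y < 1\<close> throughout, so only the other inequality can fail. Otherwise
  that other one never fails. The sign \<sigma> records which case holds for the whole pair.\<close>

lemma one_sided_distance:
  fixes a :: "'a \<Rightarrow> real"
  assumes "\<And>x x'. x \<in> X \<Longrightarrow> x' \<in> X \<Longrightarrow> \<bar>a x - a x'\<bar> \<le> 1"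
    and "\<And>y y'. y \<in> Y \<Longrightarrow> y' \<in> Y \<Longrightarrow> \<bar>a y - a y'\<bar> \<le> 1"
  obtains \<sigma> where "\<sigma> = 1 \<or> \<sigma> = -1"
    and "\<And>x y. x \<in> X \<Longrightarrow> y \<in> Y \<Longrightarrow> \<bar>a x - a y\<bar> \<le> 1 \<longleftrightarrow> \<sigma> * a y \<le> \<sigma> * a x + 1"
proof (cases "\<exists>x\<in>X. \<exists>y\<in>Y. a y > a x + 1")
  case True
  then obtain x0 y0 where *: "x0 \<in> X" "y0 \<in> Y" "a y0 > a x0 + 1" by blast
  have "\<bar>a x - a y\<bar> \<le> 1 \<longleftrightarrow> 1 * a y \<le> 1 * a x + 1" if "x \<in> X" "y \<in> Y" for x y
    using assms(1)[OF that(1) *(1)] assms(2)[OF that(2) *(2)] *(3) by linarith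
  then show ?thesis using that[of 1] by blast
next
  case False
  then have "\<bar>a x - a y\<bar> \<le> 1 \<longleftrightarrow> -1 * a y \<le> -1 * a x + 1" if "x \<in> X" "y \<in> Y" for x y
    using that by (force simp: abs_le_iff)
  then show ?thesis using that[of "-1"] by blast
qed

locale stable_clique_partition =
  fixes V :: "'a set" and E :: "'a \<Rightarrow> 'a \<Rightarrow> bool" and P :: "'a set set" and a b :: "'a \<Rightarrow> real"
  assumes graph: "graph V E"
    and realization: "\<lbrakk>v \<in> V; w \<in> V; v \<noteq> w\<rbrakk> \<Longrightarrow> E v w \<longleftrightarrow> \<bar>a v - a w\<bar> \<le> 1 \<and> \<bar>b v - b w\<bar> \<le> 1"
    and cliques: "clique_partition V E P"
    and stable: "stable_partition V E P"
begin

lemma finite_V: "finite V" and E_sym: "E v w \<Longrightarrow> E w v" and E_irrefl: "\<not> E v v"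
  using graph by (simp_all add: graph_def)

lemma partition: "partition_on V P"
  using cliques by (simp add: clique_partition_def)

lemma part_subset: "X \<in> P \<Longrightarrow> X \<subseteq> V"
  using partition by (auto simp: partition_on_def)

lemma parts_disjoint: "X \<in> P \<Longrightarrow> Y \<in> P \<Longrightarrow> X \<noteq> Y \<Longrightarrow> X \<inter> Y = {}"
  using partition disjointD unfolding partition_on_def by blast

lemma part_nonempty: "X \<in> P \<Longrightarrow> X \<noteq> {}"
  using partition by (auto simp: partition_on_def)

lemma part_clique: "X \<in> P \<Longrightarrow> v \<in> X \<Longrightarrow> w \<in> X \<Longrightarrow> v \<noteq> w \<Longrightarrow> E v w"
  using cliques by (simp add: clique_partition_def is_clique_def)

lemma finite_part: "X \<in> P \<Longrightarrow> finite X"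
  using finite_V part_subset finite_subset by blast

lemma part_width:
  assumes "X \<in> P" "x \<in> X" "x' \<in> X"
  shows "\<bar>a x - a x'\<bar> \<le> 1" "\<bar>b x - b x'\<bar> \<le> 1"
proof -
  have "x \<in> V" "x' \<in> V" using assms part_subset by auto
  then have "\<bar>a x - a x'\<bar> \<le> 1 \<and> \<bar>b x - b x'\<bar> \<le> 1"
    using part_clique[OF assms] realization[of x x'] by (cases "x = x'") simp_all
  then show "\<bar>a x - a x'\<bar> \<le> 1" "\<bar>b x - b x'\<bar> \<le> 1" by simp_all
qed

text \<open>Degrees between parts are thus functions of the colours of the quotient graph, which
  \<delta> preserves.\<close>

lemma degree_part:
  assumes "X \<in> P" "Y \<in> P" "X \<noteq> Y" "x \<in> X"
  shows "card {y\<in>Y. E x y} = edge_count E X Y div card X"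
    and "edge_count E X Y = card X * card {y\<in>Y. E x y}"
proof -
  have "{(x, y). x \<in> X \<and> y \<in> Y \<and> E x y} = Sigma X (\<lambda>x. {y\<in>Y. E x y})" by auto
  moreover have "card (Sigma X (\<lambda>x. {y\<in>Y. E x y})) = (\<Sum>z\<in>X. card {y\<in>Y. E z y})"
    using finite_part assms by (intro card_SigmaI) auto
  moreover have "(\<Sum>z\<in>X. card {y\<in>Y. E z y}) = (\<Sum>z\<in>X. card {y\<in>Y. E x y})"
    using stable assms unfolding stable_partition_def by (intro sum.cong) blast+
  ultimately show *: "edge_count E X Y = card X * card {y\<in>Y. E x y}" by (simp add: edge_count_def)
  have "card X > 0" using assms finite_part by (auto simp: card_gt_0_iff)
  then show "card {y\<in>Y. E x y} = edge_count E X Y div card X" using * by simp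
qed

lemma edge_count_commute: "edge_count E X Y = edge_count E Y X"
proof -
  have "{(x, y). x \<in> X \<and> y \<in> Y \<and> E x y} = prod.swap ` {(y, x). y \<in> Y \<and> x \<in> X \<and> E y x}"
    using E_sym by (auto simp: image_iff)
  then show ?thesis unfolding edge_count_def by (simp add: card_image)
qed

lemma ordered_blocks_parts:
  assumes XY: "X \<in> P" "Y \<in> P" "X \<noteq> Y" and pos: "0 < edge_count E X Y"
  shows "ordered_blocks X Y E a a (edge_count E X Y div card X) (edge_count E X Y div card Y)"
proof -
  obtain \<sigma> where \<sigma>: "\<sigma> = 1 \<or> \<sigma> = -1"
    "\<And>x y. x \<in> X \<Longrightarrow> y \<in> Y \<Longrightarrow> \<bar>a x - a y\<bar> \<le> 1 \<longleftrightarrow> \<sigma> * a y \<le> \<sigma> * a x + 1"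
    using one_sided_distance[of X a Y] part_width XY by metis
  obtain \<tau> where \<tau>:
    "\<And>x y. x \<in> X \<Longrightarrow> y \<in> Y \<Longrightarrow> \<bar>b x - b y\<bar> \<le> 1 \<longleftrightarrow> \<tau> * b y \<le> \<tau> * b x + 1"
    using one_sided_distance[of X b Y] part_width XY by metis
  let ?p = "\<lambda>y. \<sigma> * a y" and ?q = "\<lambda>x. \<sigma> * a x + 1" and ?r = "\<lambda>y. \<tau> * b y" and ?s = "\<lambda>x. \<tau> * b x + 1"
  have R: "E x y \<longleftrightarrow> ?p y \<le> ?q x \<and> ?r y \<le> ?s x" if "x \<in> X" "y \<in> Y" for x y
  proof -
    have "x \<in> V" "y \<in> V" "x \<noteq> y" using that part_subset XY parts_disjoint[OF XY] by auto
    then show ?thesis using realization \<sigma>(2)[OF that] \<tau>[OF that] by simp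
  qed
  have degX: "card {y\<in>Y. E x y} = edge_count E X Y div card X" if "x \<in> X" for x
    using degree_part XY that by blast
  have degY: "card {x\<in>X. E x y} = edge_count E X Y div card Y" if "y \<in> Y" for y
  proof -
    have "{x\<in>X. E x y} = {x\<in>X. E y x}" using E_sym by blast
    then show ?thesis using degree_part(1)[of Y X y] XY that edge_count_commute by metis
  qed
  obtain x0 y0 where xy0: "x0 \<in> X" "y0 \<in> Y" using part_nonempty XY by blast
  have dif: "E x' y'" if "x \<in> X" "x' \<in> X" "y \<in> Y" "y' \<in> Y" "E x y" "E x' y" "E x y'" for x x' y y'
    by (rule biregular_dominance_difunctional[where R = E, OF finite_part[OF XY(1)] finite_part[OF XY(2)] R degX degY])
      (use that in auto)
  show ?thesis
  proof
    show "finite X" "finite Y" using finite_part XY by auto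
    show "0 < edge_count E X Y div card X"
      using degree_part[OF XY xy0(1)] pos by (metis mult_0_right not_gr_zero)
    show "0 < edge_count E X Y div card Y"
      using degree_part[OF XY(2,1) XY(3)[symmetric] xy0(2)] pos edge_count_commute by (metis mult_0_right not_gr_zero)
    fix x x' y y'
    assume *: "x \<in> X" "x' \<in> X" "y \<in> Y" "y' \<in> Y" "E x y" "E x' y'" "\<not> E x y'"
    then have "\<not> E x' y" using dif by blast
    then have "(?q x < ?q x' \<and> ?p y < ?p y') \<or> (?q x' < ?q x \<and> ?p y' < ?p y)"
      using * R by (intro dominance_order[where r = ?r and s = ?s]) auto
    \<comment> \<open>A negative \<sigma> reverses both comparisons at once, which merely exchanges
      the two alternatives.\<close>
    then show "(a x < a x' \<and> a y < a y') \<or> (a x' < a x \<and> a y' < a y)"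
      using \<sigma>(1) by auto
  qed (fact degX degY dif)+
qed

text \<open>The right-hand side involves only ranks and colours. Positivity must be stated: with no
  edges both divisors are 0, and the quotients agree by the convention for division by 0.\<close>

lemma adjacent_iff:
  assumes XY: "X \<in> P" "Y \<in> P" "X \<noteq> Y" and xy: "x \<in> X" "y \<in> Y"
  shows "E x y \<longleftrightarrow> 0 < edge_count E X Y \<and>
    rank_in a X x div (edge_count E X Y div card Y) = rank_in a Y y div (edge_count E X Y div card X)"
proof (cases "0 < edge_count E X Y")
  case True
  then show ?thesis using ordered_blocks.adjacent_iff_rank[OF ordered_blocks_parts[OF XY True] xy] by simp
next
  case False
  then have "card {y\<in>Y. E x y} = 0" using degree_part(1)[OF XY xy(1)] by simp
  then show ?thesis using False xy finite_part[OF XY(2)] by auto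
qed

text \<open>Vertices of \<open>X\<close> in different blocks towards some \<open>Y\<close> have
  different \<open>a\<close>-values by \<open>ordered\<close>. Equal values therefore give equal
  neighbourhoods in every other part, hence twins.\<close>

lemma inj_on_part:
  assumes "twin_free V E" "X \<in> P"
  shows "inj_on a X"
proof (rule inj_onI, rule ccontr)
  fix x x' assume x: "x \<in> X" "x' \<in> X" "a x = a x'" "x \<noteq> x'"
  have separated: False
    if v: "v \<in> X" "w \<in> X" "a v = a w" "u \<in> closed_nbhd V E v" "u \<notin> closed_nbhd V E w" for u v w
  proof -
    have u: "u \<in> V" "u \<notin> X" "E v u" "\<not> E w u"
      using v part_clique[OF assms(2)] part_subset[OF assms(2)] by (auto simp: closed_nbhd_def)
    then obtain Y where Y: "Y \<in> P" "u \<in> Y" using partition by (auto simp: partition_on_def)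
    then have XY: "X \<noteq> Y" using u by auto
    have pos: "0 < edge_count E X Y" using adjacent_iff[OF assms(2) Y(1) XY v(1) Y(2)] u by blast
    interpret ordered_blocks X Y E a a "edge_count E X Y div card X" "edge_count E X Y div card Y"
      by (rule ordered_blocks_parts[OF assms(2) Y(1) XY pos])
    obtain y where y: "y \<in> Y" "E w y" using ex_right v by blast
    have "\<not> E v y" using difunctional[OF v(1,2) y(1) Y(2)] u y by blast
    then show False using ordered[OF v(1,2) Y(2) y(1) u(3) y(2)] v(3) by simp
  qed
  have "closed_nbhd V E x \<noteq> closed_nbhd V E x'"
    using assms x part_subset by (auto simp: twin_free_def)
  then show False using separated[of x x'] separated[of x' x] x by auto
qed

end

section \<open>Lifting a quotient automorphism by matching ranks\<close>

theorem mainTheorem15: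
  fixes V :: "'a set" and E :: "'a \<Rightarrow> 'a \<Rightarrow> bool" and P :: "'a set set"
    and \<delta> :: "'a set \<Rightarrow> 'a set"
  assumes "graph V E"
    and "unit_square_graph V E"
    and "twin_free V E"
    and "clique_stable V E P"
    and "aut_invariant V E P"
    and "quotient_aut E P \<delta>"
  shows "\<exists>\<gamma>. graph_aut V E \<gamma> \<and> (\<forall>X\<in>P. \<gamma> ` X = \<delta> X)"
proof -
  obtain f :: "'a \<Rightarrow> real \<times> real" where f: "\<forall>v\<in>V. \<forall>w\<in>V. v \<noteq> w \<longrightarrow>
       (E v w \<longleftrightarrow> max \<bar>fst (f v) - fst (f w)\<bar> \<bar>snd (f v) - snd (f w)\<bar> \<le> 1)"
    using assms(2) unfolding unit_square_graph_def by blast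
  define a where "a v = fst (f v)" for v
  interpret stable_clique_partition V E P a "\<lambda>v. snd (f v)"
  proof
    show "stable_partition V E P"
      using assms(1,4) by (intro clique_stable_imp_stable_partition) (simp_all add: graph_def)
    show "clique_partition V E P" using assms(4) by (simp add: clique_stable_def)
    show "E v w \<longleftrightarrow> \<bar>a v - a w\<bar> \<le> 1 \<and> \<bar>snd (f v) - snd (f w)\<bar> \<le> 1" if "v \<in> V" "w \<in> V" "v \<noteq> w" for v w
      using f that by (simp add: a_def)
  qed (rule assms(1))
  have \<delta>: "bij_betw \<delta> P P" "\<And>X. X \<in> P \<Longrightarrow> card (\<delta> X) = card X"
    "\<And>X Y. X \<in> P \<Longrightarrow> Y \<in> P \<Longrightarrow> X \<noteq> Y \<Longrightarrow> edge_count E (\<delta> X) (\<delta> Y) = edge_count E X Y"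
    using assms(6) by (auto simp: quotient_aut_def)
  have \<delta>P: "\<delta> X \<in> P" if "X \<in> P" for X using \<delta>(1) that by (auto simp: bij_betw_def)
  have \<delta>_inj: "\<delta> X \<noteq> \<delta> Y" if "X \<in> P" "Y \<in> P" "X \<noteq> Y" for X Y
    using \<delta>(1) that by (auto simp: bij_betw_def inj_on_def)
  have rank: "bij_betw (rank_in a X) X {..<card X}" if "X \<in> P" for X
    using bij_betw_rank_in finite_part inj_on_part assms(3) that by blast
  define part where "part v = (THE X. X \<in> P \<and> v \<in> X)" for v
  have part: "part v = X" if "X \<in> P" "v \<in> X" for v X
    unfolding part_def using that parts_disjoint by (intro the_equality) blast+
  \<comment> \<open>The vertex of the image part with the same rank as \<open>v\<close>; only values
    on \<open>V\<close> matter.\<close>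
  define \<gamma> where "\<gamma> v = inv_into (\<delta> (part v)) (rank_in a (\<delta> (part v))) (rank_in a (part v) v)" for v
  have image: "\<gamma> ` X = \<delta> X" if X: "X \<in> P" for X
  proof -
    have "\<gamma> ` X = inv_into (\<delta> X) (rank_in a (\<delta> X)) ` rank_in a X ` X"
      unfolding image_image using part[OF X] by (intro image_cong) (auto simp: \<gamma>_def)
    also have "rank_in a X ` X = {..<card (\<delta> X)}"
      using rank[OF X] \<delta>(2)[OF X] by (simp add: bij_betw_def)
    also have "inv_into (\<delta> X) (rank_in a (\<delta> X)) ` {..<card (\<delta> X)} = \<delta> X"
      using bij_betw_inv_into[OF rank[OF \<delta>P[OF X]]] by (simp add: bij_betw_def)
    finally show ?thesis .
  qed
  have rank_\<gamma>: "rank_in a (\<delta> X) (\<gamma> v) = rank_in a X v" if X: "X \<in> P" "v \<in> X" for X v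
  proof -
    have "rank_in a X v \<in> {..<card (\<delta> X)}"
      using rank[OF X(1)] \<delta>(2)[OF X(1)] X(2) by (auto simp: bij_betw_def)
    then show ?thesis
      using bij_betw_inv_into_right[OF rank[OF \<delta>P[OF X(1)]]] part[OF X] by (simp add: \<gamma>_def)
  qed
  have V: "V = \<Union>P" using partition by (simp add: partition_on_def)
  have "\<gamma> ` V = \<Union>(\<delta> ` P)" unfolding V using image by (simp add: image_Union)
  then have surj: "\<gamma> ` V = V" using \<delta>(1) V by (simp add: bij_betw_def)
  then have inj: "inj_on \<gamma> V" using finite_V by (simp add: eq_card_imp_inj_on)
  have "E (\<gamma> v) (\<gamma> w) \<longleftrightarrow> E v w" if vw: "v \<in> V" "w \<in> V" for v w
  proof -
    obtain X Y where X: "X \<in> P" "v \<in> X" and Y: "Y \<in> P" "w \<in> Y" using V vw by blast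
    have in_\<delta>: "\<gamma> v \<in> \<delta> X" "\<gamma> w \<in> \<delta> Y" using image X Y by blast+
    show ?thesis
    proof (cases "X = Y")
      case True
      \<comment> \<open>Inside one clique adjacency is inequality, so injectivity suffices.\<close>
      have "\<gamma> v = \<gamma> w \<longleftrightarrow> v = w" using inj vw by (auto simp: inj_on_def)
      then show ?thesis
        using True X Y in_\<delta> part_clique[of X v w] part_clique[OF \<delta>P[OF X(1)], of "\<gamma> v" "\<gamma> w"] E_irrefl by metis
    next
      case False
      show ?thesis
        unfolding adjacent_iff[OF X(1) Y(1) False X(2) Y(2)]
          adjacent_iff[OF \<delta>P[OF X(1)] \<delta>P[OF Y(1)] \<delta>_inj[OF X(1) Y(1) False] in_\<delta>]
          rank_\<gamma>[OF X] rank_\<gamma>[OF Y] \<delta>(2)[OF X(1)] \<delta>(2)[OF Y(1)] \<delta>(3)[OF X(1) Y(1) False] by (rule refl)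
    qed
  qed
  then have "graph_aut V E \<gamma>" using surj inj by (auto simp: graph_aut_def bij_betw_def)
  then show ?thesis using image by blast
qed

end
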